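(* Let $\Lambda_{\mu\nu}$ be a real symmetric tensor with $\Lambda_{\mu\nu} r^\mu r^\nu>0$ for all $r\in LC^+\setminus\{0\}$, all of whose eigenvalues $\Lambda_0,\Lambda_1,\Lambda_2,\Lambda_3$ are non-zero and pairwise different; let $M_\mu$ be a real four-vector and $K_\mu$ a real four-vector inside the future lightcone with $K_\mu K^\mu=1$. Let $G$ be either the group of explicit symmetries of the Higgs potential $V=-M_\mu r^\mu+\frac12\Lambda_{\mu\nu}r^\mu r^\nu$, or the group of explicit symmetries of the Higgs lagrangian $K_\mu\rho^\mu - V$, and suppose $G\cong(\mathbb{Z}_2)^k$ with $k\in\{1,2,3\}$. Then the maximal spontaneous violation of $G$ consists in removing one $\mathbb{Z}_2$ factor: for every global minimum $\langle r\rangle$ of $V$ on $LC^+$, the subgroup $\{T\in G: T\langle r\rangle=\langle r\rangle\}$ is isomorphic to $(\mathbb{Z}_2)^k$ or to $(\mathbb{Z}_2)^{k-1}$, and the second case (loss of exactly one $\mathbb{Z}_2$ factor) does occur for some choice of the parameters.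
   Context: Work in $\mathbb{R}^4$ with coordinates $r^\mu = (r_0, r_1, r_2, r_3)$ and Minkowski metric $g = \mathrm{diag}(1,-1,-1,-1)$, used to raise and lower indices. The orbit space is the closed forward lightcone (surface and interior) $LC^+ = \{ r \in \mathbb{R}^4 : r_0 \ge 0,\ r_0^2 - r_1^2 - r_2^2 - r_3^2 \ge 0\}$. Eigenvalues of $\Lambda_{\mu\nu}$ are taken with respect to the Minkowski metric: $\Lambda_{\mu\nu} e^\nu = \lambda\, g_{\mu\nu} e^\nu$. The positivity assumption on $\Lambda_{\mu\nu}$ is equivalent to the existence of a proper Lorentz frame in which $\Lambda_{\mu\nu} = \mathrm{diag}(\Lambda_0,-\Lambda_1,-\Lambda_2,-\Lambda_3)$ with $\Lambda_0>0$ and $\Lambda_0>\Lambda_1,\Lambda_2,\Lambda_3$. An explicit symmetry of the Higgs potential is an invertible linear map $T$ of $\mathbb{R}^4$ with $T(LC^+)=LC^+$ that leaves invariant, separately, the forms $\Lambda_{\mu\nu} r^\mu r^\nu$ and $M_\mu r^\mu$. An explicit symmetry of the Higgs lagrangian $K_\mu\rho^\mu-V$ (where $\rho^\mu$ is a four-vector transforming in the same way as $r^\mu$) must in addition leave invariant the linear form $K_\mu\rho^\mu$, with $T$ acting on $\rho^\mu$ as on $r^\mu$. A symmetry $T$ is spontaneously violated at the global minimum $\langle r\rangle$ if $T\langle r\rangle\ne\langle r\rangle$. *)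

theory Defs
  imports "HOL-Analysis.Analysis" "HOL-Algebra.Product_Groups"
begin

text \<open>
  Four-vectors are elements of \<^typ>\<open>real ^ 4\<close>. The index type \<^typ>\<open>4\<close> has the elements
  0, 1, 2, 3 (and 4 = 0), so component 0 is the time component. Position vectors \<open>r\<close> carry
  upper indices, whereas \<open>M\<close>, \<open>K\<close> and the tensor \<open>\<Lambda>\<close> carry lower indices;
  hence \<open>M \<bullet> r\<close> and \<open>r \<bullet> (\<Lambda> *v r)\<close> are the full contractions
  with no metric involved.
\<close>

definition minkowski :: "real ^ 4 ^ 4" where
  "minkowski = (\<chi> i j. if i = j then (if i = 0 then 1 else - 1) else 0)"

definition forward_lightcone :: "(real ^ 4) set" where
  "forward_lightcone =
     {r. r $ 0 \<ge> 0 \<and> (r $ 0)\<^sup>2 - (r $ 1)\<^sup>2 - (r $ 2)\<^sup>2 - (r $ 3)\<^sup>2 \<ge> 0}"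

definition minkowski_eigenvalue :: "real ^ 4 ^ 4 \<Rightarrow> real \<Rightarrow> bool" where
  "minkowski_eigenvalue \<Lambda> l \<longleftrightarrow> (\<exists>e. e \<noteq> 0 \<and> \<Lambda> *v e = l *\<^sub>R (minkowski *v e))"

definition positive_on_lightcone :: "real ^ 4 ^ 4 \<Rightarrow> bool" where
  "positive_on_lightcone \<Lambda> \<longleftrightarrow> (\<forall>r \<in> forward_lightcone - {0}. r \<bullet> (\<Lambda> *v r) > 0)"

text \<open>
  Four pairwise different real eigenvalues exhaust the spectrum of a tensor on \<^typ>\<open>real ^ 4\<close>,
  so no multiplicities or complex eigenvalues need to be considered.
\<close>

definition quartic_tensor :: "real ^ 4 ^ 4 \<Rightarrow> bool" where
  "quartic_tensor \<Lambda> \<longleftrightarrow>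
     transpose \<Lambda> = \<Lambda> \<and> positive_on_lightcone \<Lambda> \<and>
     (\<exists>\<Lambda>0 \<Lambda>1 \<Lambda>2 \<Lambda>3. {l. minkowski_eigenvalue \<Lambda> l} = {\<Lambda>0, \<Lambda>1, \<Lambda>2, \<Lambda>3} \<and>
        distinct [\<Lambda>0, \<Lambda>1, \<Lambda>2, \<Lambda>3] \<and> 0 \<notin> {\<Lambda>0, \<Lambda>1, \<Lambda>2, \<Lambda>3})"

text \<open>
  The metric is its own inverse, so \<open>minkowski *v K\<close> is \<open>K\<close> with its index raised.
  The normalisation forces the vector into the interior of the cone.
\<close>

definition kinetic_vector :: "real ^ 4 \<Rightarrow> bool" where
  "kinetic_vector K \<longleftrightarrow> minkowski *v K \<in> forward_lightcone \<and> K \<bullet> (minkowski *v K) = 1"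

definition higgs_potential :: "real ^ 4 ^ 4 \<Rightarrow> real ^ 4 \<Rightarrow> real ^ 4 \<Rightarrow> real" where
  "higgs_potential \<Lambda> M r = - (M \<bullet> r) + 1 / 2 * (r \<bullet> (\<Lambda> *v r))"

definition potential_symmetries ::
  "real ^ 4 ^ 4 \<Rightarrow> real ^ 4 \<Rightarrow> (real ^ 4 \<Rightarrow> real ^ 4) set" where
  "potential_symmetries \<Lambda> M =
     {T. linear T \<and> bij T \<and> T ` forward_lightcone = forward_lightcone \<and>
         (\<forall>r. T r \<bullet> (\<Lambda> *v T r) = r \<bullet> (\<Lambda> *v r)) \<and> (\<forall>r. M \<bullet> T r = M \<bullet> r)}"

definition lagrangian_symmetries ::
  "real ^ 4 ^ 4 \<Rightarrow> real ^ 4 \<Rightarrow> real ^ 4 \<Rightarrow> (real ^ 4 \<Rightarrow> real ^ 4) set" where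
  "lagrangian_symmetries \<Lambda> M K =
     {T \<in> potential_symmetries \<Lambda> M. \<forall>\<rho>. K \<bullet> T \<rho> = K \<bullet> \<rho>}"

definition global_minimum :: "real ^ 4 ^ 4 \<Rightarrow> real ^ 4 \<Rightarrow> real ^ 4 \<Rightarrow> bool" where
  "global_minimum \<Lambda> M = is_arg_min (higgs_potential \<Lambda> M) (\<lambda>r. r \<in> forward_lightcone)"

definition unbroken :: "(real ^ 4 \<Rightarrow> real ^ 4) set \<Rightarrow> real ^ 4 \<Rightarrow> (real ^ 4 \<Rightarrow> real ^ 4) set" where
  "unbroken G r = {T \<in> G. T r = r}"

definition comp_group :: "('a \<Rightarrow> 'a) set \<Rightarrow> ('a \<Rightarrow> 'a) monoid" where
  "comp_group G = \<lparr>carrier = G, mult = (\<circ>), one = id\<rparr>"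

definition Z2_power :: "nat \<Rightarrow> (nat \<Rightarrow> int) monoid" where
  "Z2_power k = product_group {..<k} (\<lambda>_. integer_mod_group 2)"

lemma comp_groupI:
  assumes "id \<in> G" and "\<And>S T. S \<in> G \<Longrightarrow> T \<in> G \<Longrightarrow> S \<circ> T \<in> G"
    and "\<And>T. T \<in> G \<Longrightarrow> bij T" and "\<And>T. T \<in> G \<Longrightarrow> inv_into UNIV T \<in> G"
  shows "group (comp_group G)"
proof (rule groupI)
  fix T assume "T \<in> carrier (comp_group G)"
  then have "inv_into UNIV T \<in> G" "inv_into UNIV T \<circ> T = id"
    using assms by (auto simp: comp_group_def bij_is_inj)
  then show "\<exists>S \<in> carrier (comp_group G). S \<otimes>\<^bsub>comp_group G\<^esub> T = \<one>\<^bsub>comp_group G\<^esub>"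
    by (auto simp: comp_group_def)
qed (use assms in \<open>auto simp: comp_group_def comp_assoc\<close>)

lemma potential_symmetries_inv:
  assumes "T \<in> potential_symmetries \<Lambda> M"
  shows "inv_into UNIV T \<in> potential_symmetries \<Lambda> M"
proof -
  have T: "linear T" "bij T" "T ` forward_lightcone = forward_lightcone"
    "\<And>r. T r \<bullet> (\<Lambda> *v T r) = r \<bullet> (\<Lambda> *v r)" "\<And>r. M \<bullet> T r = M \<bullet> r"
    using assms by (auto simp: potential_symmetries_def)
  have r: "T (inv_into UNIV T r) = r" for r
    using T(2) by (simp add: bij_is_surj surj_f_inv_f)
  have "linear (inv_into UNIV T)"
    using T(1,2) by (simp add: bij_is_inj bij_is_surj inj_linear_imp_inv_linear)
  moreover have "inv_into UNIV T ` forward_lightcone = forward_lightcone"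
    using T(2,3) by (metis bij_is_inj image_inv_f_f)
  moreover have "inv_into UNIV T r \<bullet> (\<Lambda> *v inv_into UNIV T r) = r \<bullet> (\<Lambda> *v r)" for r
    using T(4)[of "inv_into UNIV T r"] r by simp
  moreover have "M \<bullet> inv_into UNIV T r = M \<bullet> r" for r
    using T(5)[of "inv_into UNIV T r"] r by simp
  ultimately show ?thesis
    using T(2) by (simp add: potential_symmetries_def bij_imp_bij_inv)
qed

lemma potential_symmetries_comp:
  "S \<in> potential_symmetries \<Lambda> M \<Longrightarrow> T \<in> potential_symmetries \<Lambda> M \<Longrightarrow>
    S \<circ> T \<in> potential_symmetries \<Lambda> M"
  by (simp add: potential_symmetries_def linear_compose bij_comp) (metis image_image)

lemma id_potential_symmetries: "id \<in> potential_symmetries \<Lambda> M"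
  by (auto simp: potential_symmetries_def linear_id)

lemma potential_symmetries_bij: "T \<in> potential_symmetries \<Lambda> M \<Longrightarrow> bij T"
  by (simp add: potential_symmetries_def)

lemmas potential_symmetries_group =
  id_potential_symmetries potential_symmetries_comp potential_symmetries_bij
  potential_symmetries_inv

lemma potential_symmetries_inv_apply:
  "T \<in> potential_symmetries \<Lambda> M \<Longrightarrow> T (inv_into UNIV T r) = r"
  by (simp add: potential_symmetries_bij bij_is_surj surj_f_inv_f)

lemma potential_symmetries_inv_fixed:
  "T \<in> potential_symmetries \<Lambda> M \<Longrightarrow> T r = r \<Longrightarrow> inv_into UNIV T r = r"
  by (metis potential_symmetries_bij bij_is_inj inv_f_f)

lemma lagrangian_symmetries_inv:
  assumes "T \<in> lagrangian_symmetries \<Lambda> M K"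
  shows "inv_into UNIV T \<in> lagrangian_symmetries \<Lambda> M K"
proof -
  have T: "T \<in> potential_symmetries \<Lambda> M" "\<And>r. K \<bullet> T r = K \<bullet> r"
    using assms by (auto simp: lagrangian_symmetries_def)
  have "K \<bullet> inv_into UNIV T r = K \<bullet> r" for r
    using T(2)[of "inv_into UNIV T r"] potential_symmetries_inv_apply[OF T(1), of r] by simp
  then show ?thesis
    using T(1) by (simp add: lagrangian_symmetries_def potential_symmetries_inv)
qed

lemma group_potential_symmetries: "group (comp_group (potential_symmetries \<Lambda> M))"
  by (rule comp_groupI) (auto intro: potential_symmetries_group)

lemma group_lagrangian_symmetries: "group (comp_group (lagrangian_symmetries \<Lambda> M K))"
  by (rule comp_groupI)
    (auto intro: potential_symmetries_group lagrangian_symmetries_inv,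
     auto simp: lagrangian_symmetries_def intro: potential_symmetries_group)

lemma group_unbroken_potential:
  "group (comp_group (unbroken (potential_symmetries \<Lambda> M) r))"
  by (rule comp_groupI)
    (auto simp: unbroken_def intro: potential_symmetries_group potential_symmetries_inv_fixed)

lemma group_unbroken_lagrangian:
  "group (comp_group (unbroken (lagrangian_symmetries \<Lambda> M K) r))"
proof (rule comp_groupI)
  fix T assume "T \<in> unbroken (lagrangian_symmetries \<Lambda> M K) r"
  then show "inv_into UNIV T \<in> unbroken (lagrangian_symmetries \<Lambda> M K) r"
    using lagrangian_symmetries_inv potential_symmetries_inv_fixed
    by (auto simp: unbroken_def lagrangian_symmetries_def)
qed (auto simp: unbroken_def lagrangian_symmetries_def intro: potential_symmetries_group)

end

theory Submission
  imports Defs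
begin

text \<open>
  A linear bijection preserving the light cone maps null vectors to null vectors, so it is a Lorentz
  transformation up to a positive factor; the factor is 1 because it rescales the finite nonzero
  spectrum of \<open>\<Lambda>\<close> onto itself. A symmetry therefore maps each eigenvector of \<open>\<Lambda>\<close> to an
  eigenvector with the same eigenvalue and the same length, i.e. to plus or minus itself, with plus for the
  timelike one. Hence the symmetry group consists of all sign flips in a set \<open>A\<close> of spacelike
  eigendirections, namely those on which \<open>M\<close> (and \<open>K\<close>) vanish. At a minimum at most
  one coordinate in \<open>A\<close> is nonzero: with two of them, moving \<open>x\<^sub>i\<^sup>2 + x\<^sub>j\<^sup>2\<close> entirely to the
  direction with the larger eigenvalue would stay in the cone and lower the potential.
\<close>

section \<open>The Minkowski form and its causal structure\<close>

definition mdot :: "real ^ 4 \<Rightarrow> real ^ 4 \<Rightarrow> real" where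
  "mdot x y = x \<bullet> (minkowski *v y)"

lemma UNIV_4_eq: "(UNIV :: 4 set) = {0, 1, 2, 3}"
proof -
  have "i = 0 \<or> i = 1 \<or> i = 2 \<or> i = 3" for i :: 4
    using exhaust_4[of i] by auto
  then show ?thesis by blast
qed

lemma all_4_iff: "(\<forall>i::4. P i) \<longleftrightarrow> P 0 \<and> P 1 \<and> P 2 \<and> P 3"
  by (metis UNIV_4_eq UNIV_I empty_iff insert_iff)

lemma sum_UNIV_4: "(\<Sum>i\<in>(UNIV::4 set). f i) = f 0 + f 1 + f 2 + f 3"
  unfolding UNIV_4_eq by (simp add: ac_simps)

lemma mdot_components: "mdot x y = x $ 0 * y $ 0 - x $ 1 * y $ 1 - x $ 2 * y $ 2 - x $ 3 * y $ 3"
  by (simp add: mdot_def minkowski_def inner_vec_def matrix_vector_mult_def sum_UNIV_4)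

lemma forward_lightcone_iff: "r \<in> forward_lightcone \<longleftrightarrow> r $ 0 \<ge> 0 \<and> mdot r r \<ge> 0"
  by (simp add: forward_lightcone_def mdot_components power2_eq_square)

lemma mdot_linear [simp]:
  "mdot (x + y) z = mdot x z + mdot y z" "mdot z (x + y) = mdot z x + mdot z y"
  "mdot (a *\<^sub>R x) z = a * mdot x z" "mdot z (a *\<^sub>R x) = a * mdot z x"
  "mdot (x - y) z = mdot x z - mdot y z" "mdot z (x - y) = mdot z x - mdot z y"
  "mdot (- x) z = - mdot x z" "mdot z (- x) = - mdot z x"
  "mdot 0 z = 0" "mdot z 0 = 0"
  by (simp_all add: mdot_components algebra_simps)

lemma mdot_commute: "mdot x y = mdot y x"
  by (simp add: mdot_components algebra_simps)

lemma mdot_nondegenerate: "(\<And>y. mdot x y = 0) \<Longrightarrow> x = 0"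
proof -
  assume *: "\<And>y. mdot x y = 0"
  from *[of "axis 0 1"] *[of "axis 1 1"] *[of "axis 2 1"] *[of "axis 3 1"]
  show "x = 0" by (simp add: mdot_components vec_eq_iff all_4_iff axis_def)
qed

lemma time_component_nonzero:
  assumes "mdot r r \<ge> 0" "r \<noteq> 0"
  shows "r $ 0 \<noteq> 0"
proof
  assume "r $ 0 = 0"
  with assms(1) have "(r $ 1)^2 + (r $ 2)^2 + (r $ 3)^2 \<le> 0"
    by (simp add: mdot_components power2_eq_square)
  then have "r $ 1 = 0 \<and> r $ 2 = 0 \<and> r $ 3 = 0"
    by (smt (verit) zero_le_power2 power2_less_eq_zero_iff)
  with \<open>r $ 0 = 0\<close> assms(2) show False by (simp add: vec_eq_iff all_4_iff)
qed

text \<open>Reversed Cauchy-Schwarz: Lagrange's identity bounds the spatial inner product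
  \<open>s\<close>, and the time components dominate the spatial norms. Strictness comes from
  \<open>u\<close> being timelike and \<open>w $ 0\<close> being positive.\<close>

lemma timelike_pairing_pos:
  assumes "u $ 0 > 0" "mdot u u > 0" "w $ 0 \<ge> 0" "mdot w w \<ge> 0" "w \<noteq> 0"
  shows "mdot u w > 0"
proof -
  define s where "s = u $ 1 * w $ 1 + u $ 2 * w $ 2 + u $ 3 * w $ 3"
  define a where "a = (u $ 1)\<^sup>2 + (u $ 2)\<^sup>2 + (u $ 3)\<^sup>2"
  define b where "b = (w $ 1)\<^sup>2 + (w $ 2)\<^sup>2 + (w $ 3)\<^sup>2"
  have w0: "w $ 0 > 0"
    using time_component_nonzero[OF assms(4,5)] assms(3) by simp
  have "a * b - s\<^sup>2 = (u $ 1 * w $ 2 - u $ 2 * w $ 1)\<^sup>2 + (u $ 1 * w $ 3 - u $ 3 * w $ 1)\<^sup>2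
      + (u $ 2 * w $ 3 - u $ 3 * w $ 2)\<^sup>2"
    by (simp add: a_def b_def s_def power2_eq_square algebra_simps)
  then have "s\<^sup>2 \<le> a * b"
    by (smt (verit) zero_le_power2)
  also have "\<dots> \<le> a * (w $ 0)\<^sup>2"
    using assms(4)
    by (intro mult_left_mono) (simp_all add: a_def b_def mdot_components power2_eq_square)
  also have "\<dots> < (u $ 0)\<^sup>2 * (w $ 0)\<^sup>2"
    using assms(2) w0
    by (intro mult_strict_right_mono) (simp_all add: a_def mdot_components power2_eq_square)
  finally have "s\<^sup>2 < (u $ 0 * w $ 0)\<^sup>2"
    by (simp add: power_mult_distrib)
  then have "s < u $ 0 * w $ 0"
    by (rule power2_less_imp_less) (use assms(1) w0 in simp)
  then show ?thesis
    by (simp add: mdot_components s_def)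
qed

section \<open>Linear bijections preserving the light cone\<close>

lemma mdot_axis: "mdot (axis i 1) (axis j 1) = minkowski $ i $ j"
  by (simp add: mdot_def inner_axis_axis matrix_vector_mul_component inner_axis inner_axis')

text \<open>Otherwise \<open>T r\<close> lies in the open interior of the cone, so by continuity a
  whole ball around \<open>r\<close> is mapped into the cone. By injectivity the ball itself then
  lies in the cone, which is impossible around a null vector.\<close>

lemma cone_preserving_null:
  assumes "linear T" "T ` forward_lightcone = forward_lightcone" "inj T"
    and "r \<in> forward_lightcone" "mdot r r = 0"
  shows "mdot (T r) (T r) = 0"
proof (rule ccontr)
  let ?O = "{s. s $ 0 > 0 \<and> mdot s s > 0}"
  assume "mdot (T r) (T r) \<noteq> 0"
  moreover have "T r \<in> forward_lightcone"
    using assms by blast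
  ultimately have "mdot (T r) (T r) > 0" "T r $ 0 \<ge> 0"
    by (auto simp: forward_lightcone_iff)
  moreover from this have "T r $ 0 \<noteq> 0"
    using time_component_nonzero[of "T r"] by force
  ultimately have Tr: "T r \<in> ?O" by simp
  have "open ?O"
    unfolding mdot_components
    by (intro open_Collect_conj open_Collect_less continuous_intros)
  moreover have "continuous_on UNIV T"
    using assms(1) by (simp add: linear_continuous_on linear_linear)
  ultimately have "open (T -` ?O)"
    by (rule open_vimage)
  moreover have "r \<in> T -` ?O"
    using Tr by simp
  ultimately obtain d where d: "d > 0" "ball r d \<subseteq> T -` ?O"
    using openE by blast
  \<comment> \<open>A step of \<open>d / 2\<close> back in time leaves the cone: membership of
    \<open>s\<close> would require both \<open>r $ 0 \<ge> d / 2\<close> and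
    \<open>r $ 0 \<le> d / 4\<close>.\<close>
  define s where "s = r - (d / 2) *\<^sub>R axis 0 1"
  have "s \<in> ball r d"
    using d(1) by (simp add: s_def dist_norm norm_axis_1)
  then have "T s \<in> forward_lightcone"
    using d(2) by (auto simp: forward_lightcone_iff)
  then have "s \<in> forward_lightcone"
    using assms(2,3) by (metis inj_image_mem_iff)
  moreover have "mdot (axis 0 1) x = x $ 0" for x
    by (simp add: mdot_components axis_def)
  then have "mdot s s = (d / 2) * (d / 2 - 2 * r $ 0)"
    by (simp add: s_def assms(5) mdot_commute[of r "axis 0 1"] algebra_simps)
  ultimately have "d / 2 - 2 * r $ 0 \<ge> 0" "r $ 0 - d / 2 \<ge> 0"
    using d(1) by (simp_all add: forward_lightcone_iff zero_le_mult_iff, simp add: s_def)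
  then show False
    using d(1) by linarith
qed

text \<open>The null vectors \<open>axis 0 1 + w\<close>, with \<open>w\<close> spatial of length 1, determine a quadratic form up
  to a factor once it vanishes on all of them.\<close>
lemma cone_preserving_conformal:
  assumes "linear T" "bij T" "T ` forward_lightcone = forward_lightcone"
  obtains c where "c > 0" "\<And>x y. mdot (T x) (T y) = c * mdot x y"
proof -
  define b where "b i j = mdot (T (axis i 1)) (T (axis j 1))" for i j
  have b_commute: "b i j = b j i" for i j
    by (simp add: b_def mdot_commute)
  have null: "b 0 0 + p * p * b i i + q * q * b j j + 2 * p * b 0 i + 2 * q * b 0 j
      + 2 * p * q * b i j = 0"
    if "p * p + q * q = 1" "i \<noteq> 0" "j \<noteq> 0" "i \<noteq> j" for p q i j
  proof -
    let ?n = "axis 0 1 + p *\<^sub>R axis i 1 + q *\<^sub>R axis j 1"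
    have n: "?n $ 0 = 1" "mdot ?n ?n = 0"
      using that by (simp_all add: mdot_axis minkowski_def) (simp_all add: axis_def algebra_simps)
    have "?n \<in> forward_lightcone"
      by (simp only: forward_lightcone_iff n) simp
    with n(2) have "mdot (T ?n) (T ?n) = 0"
      using cone_preserving_null[OF assms(1,3) bij_is_inj[OF assms(2)]] by blast
    then show ?thesis
      using b_commute[of i j] b_commute[of 0 i] b_commute[of 0 j]
      by (simp add: linear_add[OF assms(1)] linear_scale[OF assms(1)] b_def algebra_simps)
  qed
  define c where "c = b 0 0"
  \<comment> \<open>The null vectors \<open>axis 0 1 + axis i 1\<close> and
    \<open>axis 0 1 - axis i 1\<close> suffice: adding and subtracting their equations separates
    \<open>b i i\<close> from \<open>b 0 i\<close>. The index \<open>j\<close> is a placeholder with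
    coefficient 0.\<close>
  have diag: "b 0 i = 0" "b i i = - c" if "i \<noteq> 0" for i
  proof -
    obtain j :: 4 where "j \<noteq> 0" "j \<noteq> i"
      using that by (cases "i = 1") (auto intro: that[of 2] that[of 1])
    then show "b 0 i = 0" "b i i = - c"
      using null[of 1 0 i j] null[of "-1" 0 i j] that by (auto simp: c_def)
  qed
  \<comment> \<open>The rational point (3/5, 4/5) of the unit circle has both coordinates nonzero,
    so once the other terms cancel only a nonzero multiple of \<open>b i j\<close> remains.\<close>
  have off: "b i j = 0" if "i \<noteq> 0" "j \<noteq> 0" "i \<noteq> j" for i j
    using null[of "3/5" "4/5" i j] that by (simp add: diag c_def[symmetric])
  have expand: "T x = x $ 0 *\<^sub>R T (axis 0 1) + x $ 1 *\<^sub>R T (axis 1 1) + x $ 2 *\<^sub>R T (axis 2 1)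
      + x $ 3 *\<^sub>R T (axis 3 1)" for x
  proof -
    have "x = x $ 0 *\<^sub>R axis 0 1 + x $ 1 *\<^sub>R axis 1 1 + x $ 2 *\<^sub>R axis 2 1 + x $ 3 *\<^sub>R axis 3 1"
      by (simp add: vec_eq_iff all_4_iff axis_def)
    then have "T x = T (x $ 0 *\<^sub>R axis 0 1 + x $ 1 *\<^sub>R axis 1 1 + x $ 2 *\<^sub>R axis 2 1
        + x $ 3 *\<^sub>R axis 3 1)"
      by simp
    then show ?thesis
      by (simp only: linear_add[OF assms(1)] linear_scale[OF assms(1)])
  qed
  have conformal: "mdot (T x) (T y) = c * mdot x y" for x y
    unfolding expand[of x] expand[of y]
    by (simp add: b_def[symmetric] diag b_commute[of 1 0] b_commute[of 2 0] b_commute[of 3 0] off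
        c_def[symmetric] mdot_components[of x y] algebra_simps)
  have "T (axis 0 1) \<in> forward_lightcone"
    using assms(3) by (force simp: forward_lightcone_iff mdot_components axis_def)
  then have "c \<ge> 0"
    by (simp add: c_def b_def forward_lightcone_iff)
  \<comment> \<open>For \<open>c = 0\<close> surjectivity makes \<open>T (axis 0 1)\<close>
    orthogonal to every vector, hence 0, against injectivity.\<close>
  moreover have "c \<noteq> 0"
  proof
    assume "c = 0"
    then have "mdot (T (axis 0 1)) y = 0" for y
      using conformal[of "axis 0 1" "inv_into UNIV T y"] assms(2) by (simp add: bij_is_surj surj_f_inv_f)
    then have "T (axis 0 1) = T 0"
      using mdot_nondegenerate linear_0[OF assms(1)] by metis
    then have "axis (0::4) (1::real) = 0"
      using assms(2) by (simp add: bij_is_inj inj_eq)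
    then show False by (simp add: axis_eq_0_iff)
  qed
  ultimately show ?thesis
    using conformal that[of c] by simp
qed

section \<open>From conformal maps to isometries by way of the spectrum\<close>

lemma mdot_sum_right: "mdot x (\<Sum>i\<in>A. f i) = (\<Sum>i\<in>A. mdot x (f i))"
  by (induction A rule: infinite_finite_induct) simp_all

lemma minkowski_diag_sq [simp]: "minkowski $ i $ i * minkowski $ i $ i = 1"
  by (simp add: minkowski_def)

lemma mult_minkowski_diag: "minkowski $ i $ i * (minkowski $ i $ i * x) = x"
  by (simp flip: mult.assoc)

lemma symmetric_form_commute:
  fixes \<Lambda> :: "real ^ 4 ^ 4"
  assumes "transpose \<Lambda> = \<Lambda>"
  shows "x \<bullet> (\<Lambda> *v y) = y \<bullet> (\<Lambda> *v x)"
  by (metis assms dot_lmul_matrix inner_commute transpose_matrix_vector)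

lemma quadratic_form_polarization:
  fixes \<Lambda> :: "real ^ 4 ^ 4"
  assumes "transpose \<Lambda> = \<Lambda>" "linear T" "\<And>r. T r \<bullet> (\<Lambda> *v T r) = r \<bullet> (\<Lambda> *v r)"
  shows "T x \<bullet> (\<Lambda> *v T y) = x \<bullet> (\<Lambda> *v y)"
  using assms(3)[of "x + y"] assms(3)[of x] assms(3)[of y]
    symmetric_form_commute[OF assms(1), of x y] symmetric_form_commute[OF assms(1), of "T x" "T y"]
  by (simp add: linear_add[OF assms(2)] matrix_vector_right_distrib inner_add_left inner_add_right)

text \<open>Every test vector has the form \<open>T s\<close>. Pulling back along \<open>T\<close>
  leaves the form of \<Lambda> unchanged and multiplies the metric by \<open>c\<close>, so the
  eigenvalue is divided by \<open>c\<close>.\<close>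

lemma conformal_eigenvalue:
  assumes "transpose \<Lambda> = \<Lambda>" "linear T" "surj T"
    and "\<And>r. T r \<bullet> (\<Lambda> *v T r) = r \<bullet> (\<Lambda> *v r)"
    and "c \<noteq> 0" "\<And>x y. mdot (T x) (T y) = c * mdot x y"
    and "\<Lambda> *v v = l *\<^sub>R (minkowski *v v)"
  shows "\<Lambda> *v T v = (l / c) *\<^sub>R (minkowski *v T v)"
proof -
  have "t \<bullet> (\<Lambda> *v T v) = t \<bullet> ((l / c) *\<^sub>R (minkowski *v T v))" for t
  proof -
    obtain s where t: "t = T s" using assms(3) by blast
    have "t \<bullet> (\<Lambda> *v T v) = l * mdot s v"
      using quadratic_form_polarization[OF assms(1,2,4)] by (simp add: t assms(7) mdot_def)
    also have "\<dots> = (l / c) * mdot t (T v)"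
      using assms(5,6) by (simp add: t)
    finally show ?thesis by (simp add: mdot_def)
  qed
  then show ?thesis
    by (metis vector_eq_ldot)
qed

text \<open>Division by the conformal factor \<open>c\<close> is an injective self-map of the finite
  spectrum, hence a permutation of it. Comparing the products of all eigenvalues, which are nonzero,
  gives \<open>c ^ card ?S = 1\<close>, and \<open>c > 0\<close> leaves only
  \<open>c = 1\<close>.\<close>

lemma form_symmetry_isometry:
  assumes "transpose \<Lambda> = \<Lambda>" "linear T" "bij T" "T ` forward_lightcone = forward_lightcone"
    and "\<And>r. T r \<bullet> (\<Lambda> *v T r) = r \<bullet> (\<Lambda> *v r)"
    and "finite {l. minkowski_eigenvalue \<Lambda> l}" "{l. minkowski_eigenvalue \<Lambda> l} \<noteq> {}"
    and "\<not> minkowski_eigenvalue \<Lambda> 0"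
  shows "mdot (T x) (T y) = mdot x y"
proof -
  obtain c where c: "c > 0" "\<And>x y. mdot (T x) (T y) = c * mdot x y"
    using cone_preserving_conformal[OF assms(2,3,4)] by metis
  let ?S = "{l. minkowski_eigenvalue \<Lambda> l}"
  have "l / c \<in> ?S" if l: "l \<in> ?S" for l
  proof -
    obtain v where v: "v \<noteq> 0" "\<Lambda> *v v = l *\<^sub>R (minkowski *v v)"
      using l by (auto simp: minkowski_eigenvalue_def)
    have "T v \<noteq> 0"
      using v(1) assms(2,3) by (metis bij_is_inj inj_eq linear_0)
    then show ?thesis
      using conformal_eigenvalue[OF assms(1,2) bij_is_surj[OF assms(3)] assms(5) _ c(2) v(2)] c(1)
      by (auto simp: minkowski_eigenvalue_def)
  qed
  moreover have inj: "inj_on (\<lambda>l. l / c) ?S"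
    using c(1) by (auto simp: inj_on_def)
  ultimately have "(\<lambda>l. l / c) ` ?S = ?S"
    using assms(6) by (intro endo_inj_surj) auto
  then have "\<Prod>?S = prod (\<lambda>l. l) ((\<lambda>l. l / c) ` ?S)"
    by simp
  also have "\<dots> = \<Prod>?S / c ^ card ?S"
    using inj by (simp add: prod.reindex prod_dividef)
  finally have "c ^ card ?S = 1"
    using assms(6,8) c(1) by (simp add: field_simps prod_zero_iff)
  moreover have "card ?S > 0"
    using assms(6,7) by (simp add: card_gt_0_iff)
  ultimately have "c = 1"
    using c(1) by (metis less_eq_real_def power_eq_1_iff abs_of_pos real_norm_def not_gr0)
  with c(2) show ?thesis by simp
qed

text \<open>Splits the computation of a symmetry group in two: every symmetry is some flip
  \<open>f B\<close>, and the admissible \<open>B\<close> are exactly the subsets of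
  \<open>A\<close>.\<close>

lemma eq_image_PowI:
  assumes "S \<subseteq> range f" and sub: "\<And>B. B \<subseteq> A \<longleftrightarrow> f B \<in> S"
  shows "S = f ` Pow A"
proof
  show "S \<subseteq> f ` Pow A"
  proof
    fix T assume "T \<in> S"
    moreover from this obtain B where "T = f B" using assms(1) by blast
    ultimately show "T \<in> f ` Pow A" using sub[of B] by simp
  qed
qed (use sub in blast)

section \<open>The elementary abelian 2-group\<close>

lemma group_Z2_power: "Group.group (Z2_power k)"
  by (simp add: Z2_power_def)

lemma carrier_Z2_power: "carrier (Z2_power k) = {..<k} \<rightarrow>\<^sub>E {0, 1}"
proof -
  have "{0..<2} = {0, 1 :: int}" by auto
  then show ?thesis
    by (simp add: Z2_power_def carrier_integer_mod_group)
qed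

lemma mult_Z2_power: "f \<otimes>\<^bsub>Z2_power k\<^esub> g = (\<lambda>j\<in>{..<k}. (f j + g j) mod 2)"
  by (simp add: Z2_power_def)

lemma card_Z2_power: "card (carrier (Z2_power k)) = 2 ^ k"
  by (simp add: carrier_Z2_power card_PiE numeral_2_eq_2)

section \<open>Coordinates in a future-oriented Lorentz-orthonormal eigenbasis\<close>

locale eigenframe =
  fixes \<Lambda> :: "real ^ 4 ^ 4" and e :: "4 \<Rightarrow> real ^ 4" and lam :: "4 \<Rightarrow> real"
  assumes symmetric: "transpose \<Lambda> = \<Lambda>"
    and ortho: "mdot (e i) (e j) = minkowski $ i $ j"
    and forward: "e 0 $ 0 > 0"
    and eigen: "\<Lambda> *v e i = lam i *\<^sub>R (minkowski *v e i)"
    and inj: "inj lam" and nonzero: "lam i \<noteq> 0"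
begin

text \<open>The sign compensates for the square -1 of the spacelike \<open>e i\<close>, which makes
  \<open>coord\<close> the dual basis of \<open>e\<close>.\<close>

definition coord :: "4 \<Rightarrow> real ^ 4 \<Rightarrow> real" where
  "coord i r = minkowski $ i $ i * mdot (e i) r"

definition comb :: "(4 \<Rightarrow> real) \<Rightarrow> real ^ 4" where
  "comb x = (\<Sum>i\<in>UNIV. x i *\<^sub>R e i)"

definition flip :: "4 set \<Rightarrow> real ^ 4 \<Rightarrow> real ^ 4" where
  "flip B r = comb (\<lambda>i. if i \<in> B then - coord i r else coord i r)"

lemma coord_e: "coord i (e j) = (if i = j then 1 else 0)"
  by (simp add: coord_def ortho) (simp add: minkowski_def)

lemma coord_linear: "linear (coord i)"
  by (rule linearI) (simp_all add: coord_def algebra_simps)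

lemma coord_comb [simp]: "coord i (comb x) = x i"
proof -
  have "coord i (comb x) = (\<Sum>j\<in>UNIV. x j * coord i (e j))"
    by (simp add: comb_def coord_def mdot_sum_right sum_distrib_left algebra_simps)
  also have "\<dots> = (\<Sum>j\<in>UNIV. if i = j then x j else 0)"
    by (intro sum.cong) (simp_all add: coord_e)
  finally show ?thesis by simp
qed

text \<open>\<open>coord_comb\<close> yields the linear independence of the frame; in finite
  dimension an injective linear endomorphism is onto, so the frame spans.\<close>

lemma comb_coord [simp]: "comb (\<lambda>i. coord i r) = r"
proof -
  let ?f = "\<lambda>v :: real ^ 4. comb (($) v)"
  have "linear ?f"
    by (rule linearI) (simp_all add: comb_def scaleR_add_left sum.distrib scaleR_sum_right)
  moreover have "inj ?f"
    by (metis (no_types, lifting) coord_comb injI vec_eq_iff)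
  ultimately obtain v where "r = ?f v"
    using linear_injective_imp_surjective by blast
  then show ?thesis by simp
qed

lemma coord_eqI: "(\<And>i. coord i r = coord i s) \<Longrightarrow> r = s"
  by (metis comb_coord ext)

lemma inner_comb: "v \<bullet> comb x = (\<Sum>i\<in>UNIV. x i * (v \<bullet> e i))"
  by (simp add: comb_def inner_sum_right)

lemma linear_comb: "linear T \<Longrightarrow> T (comb x) = (\<Sum>i\<in>UNIV. x i *\<^sub>R T (e i))"
  by (simp add: comb_def linear_sum linear_scale)

lemma form_coord: "r \<bullet> (\<Lambda> *v s) = (\<Sum>i\<in>UNIV. minkowski $ i $ i * lam i * coord i r * coord i s)"
proof -
  have "r \<bullet> (\<Lambda> *v s) = r \<bullet> (\<Lambda> *v comb (\<lambda>i. coord i s))" by simp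
  also have "\<dots> = (\<Sum>i\<in>UNIV. coord i s * (r \<bullet> (\<Lambda> *v e i)))"
    by (subst linear_comb) (simp_all add: inner_sum_right)
  also have "\<dots> = (\<Sum>i\<in>UNIV. coord i s * (lam i * mdot (e i) r))"
    by (simp add: eigen mdot_def[symmetric] mdot_commute[of r "e i" for i])
  also have "\<dots> = (\<Sum>i\<in>UNIV. minkowski $ i $ i * lam i * coord i r * coord i s)"
    by (intro sum.cong) (simp_all add: coord_def ac_simps mult_minkowski_diag)
  finally show ?thesis .
qed

lemma mdot_coord: "mdot r s = (\<Sum>i\<in>UNIV. minkowski $ i $ i * coord i r * coord i s)"
proof -
  have "mdot r s = mdot r (comb (\<lambda>i. coord i s))" by simp
  also have "\<dots> = (\<Sum>i\<in>UNIV. coord i s * mdot (e i) r)"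
    unfolding comb_def mdot_sum_right by (simp add: mdot_commute[of r "e i" for i])
  also have "\<dots> = (\<Sum>i\<in>UNIV. minkowski $ i $ i * coord i r * coord i s)"
    by (intro sum.cong) (simp_all add: coord_def ac_simps mult_minkowski_diag)
  finally show ?thesis .
qed

lemma coord_0: "coord 0 r = mdot (e 0) r"
  by (simp add: coord_def minkowski_def)

text \<open>The forward cone does not depend on the frame: on nonzero causal vectors, the sign of
  the pairing with the future timelike \<open>e 0\<close> agrees with the sign of the time
  component.\<close>

lemma forward_lightcone_coord: "r \<in> forward_lightcone \<longleftrightarrow> coord 0 r \<ge> 0 \<and> mdot r r \<ge> 0"
proof -
  have pos: "mdot (e 0) s > 0" if "s $ 0 \<ge> 0" "mdot s s \<ge> 0" "s \<noteq> 0" for s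
    by (rule timelike_pairing_pos) (use that forward ortho[of 0 0] in \<open>simp_all add: minkowski_def\<close>)
  have "r $ 0 \<ge> 0 \<longleftrightarrow> mdot (e 0) r \<ge> 0" if "mdot r r \<ge> 0" "r \<noteq> 0"
  proof (cases "r $ 0 \<ge> 0")
    case True
    with pos[of r] that show ?thesis by simp
  next
    case False
    with pos[of "- r"] that show ?thesis by simp
  qed
  then show ?thesis
    by (cases "r = 0") (auto simp: forward_lightcone_iff coord_0)
qed

text \<open>An eigenvector has some nonzero coordinate \<open>i\<close>, and pairing it with
  \<open>e i\<close> forces its eigenvalue to be \<open>lam i\<close>.\<close>

lemma eigenvalue_iff: "minkowski_eigenvalue \<Lambda> l \<longleftrightarrow> l \<in> range lam"
proof
  assume "minkowski_eigenvalue \<Lambda> l"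
  then obtain v where v: "v \<noteq> 0" "\<Lambda> *v v = l *\<^sub>R (minkowski *v v)"
    by (auto simp: minkowski_eigenvalue_def)
  obtain i where i: "coord i v \<noteq> 0"
    using v(1) coord_eqI[of v 0] by (auto simp: coord_def)
  have "e i \<bullet> (\<Lambda> *v v) = v \<bullet> (\<Lambda> *v e i)"
    by (rule symmetric_form_commute[OF symmetric])
  then have "l * mdot (e i) v = lam i * mdot (e i) v"
    by (simp add: eigen v(2) mdot_def[symmetric] mdot_commute[of v])
  with i show "l \<in> range lam" by (auto simp: coord_def)
next
  assume "l \<in> range lam"
  then obtain i where "l = lam i" by blast
  moreover have "e i \<noteq> 0" using coord_e[of i i] by (auto simp: coord_def)
  ultimately show "minkowski_eigenvalue \<Lambda> l"
    using eigen by (auto simp: minkowski_eigenvalue_def)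
qed

section \<open>Sign flips of frame coordinates\<close>

lemma coord_flip [simp]: "coord i (flip B r) = (if i \<in> B then - coord i r else coord i r)"
  by (simp add: flip_def)

lemma flip_linear: "linear (flip B)"
  by (rule linearI; rule coord_eqI) (simp_all add: linear_add[OF coord_linear] linear_scale[OF coord_linear])

lemma flip_comp: "flip B \<circ> flip C = flip (B - C \<union> (C - B))"
  by (rule ext, rule coord_eqI) auto

lemma flip_eq_iff: "flip B = flip C \<longleftrightarrow> B = C"
proof
  assume "flip B = flip C"
  then have "coord i (flip B (e i)) = coord i (flip C (e i))" for i by simp
  note * = this
  have "i \<in> B \<longleftrightarrow> i \<in> C" for i
    using *[of i] by (simp add: coord_e split: if_splits)
  then show "B = C" by blast
qed simp

lemma flip_fixed_iff: "flip B r = r \<longleftrightarrow> (\<forall>i\<in>B. coord i r = 0)"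
proof
  assume "flip B r = r"
  then have "coord i (flip B r) = coord i r" for i by simp
  then show "\<forall>i\<in>B. coord i r = 0"
    by (metis coord_flip equal_neg_zero neg_equal_zero)
qed (auto intro: coord_eqI)

lemma inner_flip: "v \<bullet> flip B r = v \<bullet> r \<longleftrightarrow> (\<Sum>i\<in>B. coord i r * (v \<bullet> e i)) = 0"
proof -
  \<comment> \<open>Each flipped direction changes the pairing by twice its own
    contribution.\<close>
  have "v \<bullet> flip B r = (\<Sum>i\<in>UNIV. coord i r * (v \<bullet> e i) - (if i \<in> B then 2 * (coord i r * (v \<bullet> e i)) else 0))"
    unfolding flip_def inner_comb by (intro sum.cong) auto
  also have "\<dots> = v \<bullet> comb (\<lambda>i. coord i r) - 2 * (\<Sum>i\<in>B. coord i r * (v \<bullet> e i))"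
    unfolding inner_comb by (simp add: sum_subtractf sum.If_cases sum_distrib_left)
  finally show ?thesis by auto
qed

lemma inner_flip_all: "(\<forall>r. v \<bullet> flip B r = v \<bullet> r) \<longleftrightarrow> (\<forall>i\<in>B. v \<bullet> e i = 0)"
proof
  assume *: "\<forall>r. v \<bullet> flip B r = v \<bullet> r"
  show "\<forall>i\<in>B. v \<bullet> e i = 0"
  proof
    fix i assume "i \<in> B"
    have "(\<Sum>j\<in>B. coord j (e i) * (v \<bullet> e j)) = 0"
      using * inner_flip by blast
    moreover have "coord j (e i) * (v \<bullet> e j) = (if j = i then v \<bullet> e i else 0)" for j
      by (simp add: coord_e)
    ultimately show "v \<bullet> e i = 0" using \<open>i \<in> B\<close> by simp
  qed
qed (simp add: inner_flip)

lemma flip_preserves_cone: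
  assumes "0 \<notin> B"
  shows "flip B ` forward_lightcone = forward_lightcone"
proof -
  have sub: "flip B r \<in> forward_lightcone" if "r \<in> forward_lightcone" for r
  proof -
    have "mdot (flip B r) (flip B r) = mdot r r"
      unfolding mdot_coord by (intro sum.cong) auto
    with that assms show ?thesis by (simp add: forward_lightcone_coord)
  qed
  \<comment> \<open>As flips are involutions, mapping the cone into itself already means mapping it
    onto itself.\<close>
  have "flip B (flip B r) = r" for r
    by (rule coord_eqI) simp
  then show ?thesis
    using sub by (metis (no_types, lifting) image_iff subsetI subset_antisym image_subsetI)
qed

section \<open>Determination of the two symmetry groups\<close>

lemma flip_mem_potential_symmetries:
  "flip B \<in> potential_symmetries \<Lambda> M \<longleftrightarrow> 0 \<notin> B \<and> (\<forall>i\<in>B. M \<bullet> e i = 0)"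
proof -
  have "bij (flip B)"
    by (rule o_bij[of "flip B"]) (auto simp: fun_eq_iff intro: coord_eqI)
  moreover have "flip B r \<bullet> (\<Lambda> *v flip B r) = r \<bullet> (\<Lambda> *v r)" for r
    unfolding form_coord by (intro sum.cong) auto
  \<comment> \<open>A flip of the time direction would send \<open>e 0\<close> out of the forward
    cone.\<close>
  moreover have "0 \<notin> B" if "flip B ` forward_lightcone = forward_lightcone"
  proof
    assume "0 \<in> B"
    have "e 0 \<in> forward_lightcone"
      using forward ortho[of 0 0] by (simp add: forward_lightcone_iff minkowski_def)
    then have "coord 0 (flip B (e 0)) \<ge> 0"
      using that forward_lightcone_coord by blast
    then show False using \<open>0 \<in> B\<close> by (simp add: coord_e)
  qed
  ultimately show ?thesis
    using flip_preserves_cone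
    by (auto simp: potential_symmetries_def flip_linear inner_flip_all)
qed

text \<open>Distinct eigenvalues make the eigenspaces lines, so \<open>T\<close> scales each
  \<open>e i\<close>, and the isometry property makes the scale a sign. Excluding the time flip is
  left to \<open>flip_mem_potential_symmetries\<close>.\<close>

lemma potential_symmetry_is_flip:
  assumes "T \<in> potential_symmetries \<Lambda> M"
  shows "T \<in> range flip"
proof -
  have T: "linear T" "bij T" "T ` forward_lightcone = forward_lightcone"
    "\<And>r. T r \<bullet> (\<Lambda> *v T r) = r \<bullet> (\<Lambda> *v r)"
    using assms by (auto simp: potential_symmetries_def)
  have iso: "mdot (T x) (T y) = mdot x y" for x y
    by (rule form_symmetry_isometry[OF symmetric T]) (use nonzero in \<open>auto simp: eigenvalue_iff\<close>)
  have eig: "\<Lambda> *v T (e i) = lam i *\<^sub>R (minkowski *v T (e i))" for i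
    using conformal_eigenvalue[OF symmetric T(1) bij_is_surj[OF T(2)] T(4), of 1 "e i" "lam i"] iso eigen
    by simp
  \<comment> \<open>\<open>T (e i)\<close> and \<open>e j\<close> are eigenvectors for different
    eigenvalues, hence orthogonal.\<close>
  have off: "coord j (T (e i)) = 0" if "j \<noteq> i" for i j
  proof -
    have "e j \<bullet> (\<Lambda> *v T (e i)) = T (e i) \<bullet> (\<Lambda> *v e j)"
      by (rule symmetric_form_commute[OF symmetric])
    then have "lam i * mdot (e j) (T (e i)) = lam j * mdot (e j) (T (e i))"
      by (simp add: eigen eig mdot_def[symmetric] mdot_commute[of _ "e j"])
    then show ?thesis
      using that inj by (auto simp: coord_def inj_eq)
  qed
  define a where "a i = coord i (T (e i))" for i
  have Te: "T (e i) = a i *\<^sub>R e i" for i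
    by (rule coord_eqI) (auto simp: off a_def coord_e linear_scale[OF coord_linear])
  have "a i * a i * mdot (e i) (e i) = mdot (e i) (e i)" for i
    using iso[of "e i" "e i"] by (simp add: Te)
  moreover have "mdot (e i) (e i) \<noteq> 0" for i
    by (simp add: ortho) (simp add: minkowski_def)
  ultimately have "a i * a i = 1" for i
    by (metis mult_cancel_right2)
  then have a: "a i = 1 \<or> a i = - 1" for i
    by (simp add: square_eq_1_iff)
  have "coord i (T r) = a i * coord i r" for i r
  proof -
    have "T r = (\<Sum>i\<in>UNIV. coord i r *\<^sub>R T (e i))"
      using linear_comb[OF T(1), of "\<lambda>i. coord i r"] by simp
    also have "\<dots> = comb (\<lambda>i. a i * coord i r)"
      by (simp add: comb_def Te mult.commute)
    finally show ?thesis by simp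
  qed
  then have coord_T: "coord i (T r) = a i * coord i r" for i r .
  have "T r = flip {i. a i = - 1} r" for r
  proof (rule coord_eqI)
    fix i
    show "coord i (T r) = coord i (flip {i. a i = - 1} r)"
      using a[of i] by (auto simp: coord_T)
  qed
  then have "T = flip {i. a i = - 1}" by blast
  then show ?thesis by blast
qed

lemma potential_symmetries_eq:
  "potential_symmetries \<Lambda> M = flip ` Pow {i. i \<noteq> 0 \<and> M \<bullet> e i = 0}"
proof -
  have "B \<subseteq> {i. i \<noteq> 0 \<and> M \<bullet> e i = 0} \<longleftrightarrow> flip B \<in> potential_symmetries \<Lambda> M" for B
    by (auto simp: flip_mem_potential_symmetries)
  then show ?thesis
    using potential_symmetry_is_flip by (intro eq_image_PowI subsetI)
qed

lemma lagrangian_symmetries_eq: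
  "lagrangian_symmetries \<Lambda> M K = flip ` Pow {i. i \<noteq> 0 \<and> M \<bullet> e i = 0 \<and> K \<bullet> e i = 0}"
proof -
  have "B \<subseteq> {i. i \<noteq> 0 \<and> M \<bullet> e i = 0 \<and> K \<bullet> e i = 0} \<longleftrightarrow>
      flip B \<in> potential_symmetries \<Lambda> M \<and> (\<forall>r. K \<bullet> flip B r = K \<bullet> r)" for B
    by (auto simp: flip_mem_potential_symmetries inner_flip_all)
  moreover have "lagrangian_symmetries \<Lambda> M K \<subseteq> range flip"
    unfolding lagrangian_symmetries_def using potential_symmetry_is_flip by blast
  ultimately show ?thesis
    by (intro eq_image_PowI) (simp_all add: lagrangian_symmetries_def)
qed

section \<open>Group structure of flips and of their stabilizers\<close>

lemma unbroken_eq: "unbroken (flip ` Pow A) r = flip ` Pow {i \<in> A. coord i r = 0}"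
  by (auto simp: unbroken_def flip_fixed_iff)

text \<open>Composition of flips is symmetric difference of sets, which is addition mod 2 of
  indicator functions. The bijection \<open>h\<close> numbers the elements of \<open>A\<close>, and
  \<open>\<phi>\<close> sends a 0/1 function to the flip of the set it indicates.\<close>

lemma flips_iso_Z2_power: "comp_group (flip ` Pow A) \<cong> Z2_power (card A)"
proof -
  let ?k = "card A"
  obtain h where h: "bij_betw h {..<?k} A"
    using ex_bij_betw_nat_finite[of A] by (auto simp: atLeast0LessThan)
  define X where "X f = {j. j < ?k \<and> f j = (1::int)}" for f
  define \<phi> where "\<phi> f = flip (h ` X f)" for f
  have inj: "inj_on h {..<?k}" and im: "h ` {..<?k} = A"
    using h by (auto simp: bij_betw_def)
  have X_sub: "X f \<subseteq> {..<?k}" for f by (auto simp: X_def)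
  have "\<phi> \<in> hom (Z2_power ?k) (comp_group (flip ` Pow A))"
  proof (rule homI)
    fix f assume "f \<in> carrier (Z2_power ?k)"
    show "\<phi> f \<in> carrier (comp_group (flip ` Pow A))"
      using X_sub[of f] im by (auto simp: \<phi>_def comp_group_def)
  next
    fix f g assume fg: "f \<in> carrier (Z2_power ?k)" "g \<in> carrier (Z2_power ?k)"
    have "j \<in> X (f \<otimes>\<^bsub>Z2_power ?k\<^esub> g) \<longleftrightarrow> j \<in> X f - X g \<union> (X g - X f)" for j
    proof (cases "j < ?k")
      case True
      then have "f j \<in> {0, 1}" "g j \<in> {0, 1}"
        using fg by (auto simp: carrier_Z2_power)
      with True show ?thesis
        by (auto simp: X_def mult_Z2_power)
    qed (simp add: X_def)
    then have "X (f \<otimes>\<^bsub>Z2_power ?k\<^esub> g) = X f - X g \<union> (X g - X f)" by blast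
    moreover have "h ` (Y - Z) = h ` Y - h ` Z" if "Y \<subseteq> {..<?k}" "Z \<subseteq> {..<?k}" for Y Z
      using inj that by (intro inj_on_image_set_diff) auto
    ultimately show "\<phi> (f \<otimes>\<^bsub>Z2_power ?k\<^esub> g) = \<phi> f \<otimes>\<^bsub>comp_group (flip ` Pow A)\<^esub> \<phi> g"
      using X_sub by (simp add: \<phi>_def comp_group_def flip_comp image_Un)
  qed
  moreover have "inj_on \<phi> (carrier (Z2_power ?k))"
  proof (rule inj_onI)
    fix f g assume fg: "f \<in> carrier (Z2_power ?k)" "g \<in> carrier (Z2_power ?k)" and "\<phi> f = \<phi> g"
    then have XX: "X f = X g"
      using inj_on_image_eq_iff[OF inj X_sub X_sub] by (simp add: \<phi>_def flip_eq_iff)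
    show "f = g"
    proof (rule PiE_ext)
      show "f \<in> {..<?k} \<rightarrow>\<^sub>E {0, 1}" "g \<in> {..<?k} \<rightarrow>\<^sub>E {0, 1}"
        using fg by (auto simp: carrier_Z2_power)
      fix j assume j: "j \<in> {..<?k}"
      then have "f j \<in> {0, 1}" "g j \<in> {0, 1}"
        using fg by (auto simp: carrier_Z2_power)
      moreover have "f j = 1 \<longleftrightarrow> g j = 1"
        using XX j by (auto simp: X_def)
      ultimately show "f j = g j" by auto
    qed
  qed
  moreover have "carrier (comp_group (flip ` Pow A)) \<subseteq> \<phi> ` carrier (Z2_power ?k)"
  proof
    fix T assume "T \<in> carrier (comp_group (flip ` Pow A))"
    then obtain B where B: "B \<subseteq> A" "T = flip B" by (auto simp: comp_group_def)
    let ?f = "\<lambda>j\<in>{..<?k}. if h j \<in> B then 1 else (0::int)"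
    have "X ?f = {j. j < ?k \<and> h j \<in> B}" by (auto simp: X_def split: if_splits)
    then have "h ` X ?f = B" using B(1) im by auto
    then have "T = \<phi> ?f" by (simp add: \<phi>_def B(2))
    moreover have "?f \<in> carrier (Z2_power ?k)" by (simp add: carrier_Z2_power)
    ultimately show "T \<in> \<phi> ` carrier (Z2_power ?k)" by blast
  qed
  ultimately have "\<phi> \<in> iso (Z2_power ?k) (comp_group (flip ` Pow A))"
    by (auto simp: iso_iff dest: hom_in_carrier)
  then show ?thesis
    using group.iso_sym[OF group_Z2_power] by (auto simp: is_iso_def)
qed

text \<open>The exponent can be read off from the group order, because \<open>2 ^ k\<close>
  determines \<open>k\<close>.\<close>

lemma flips_iso_Z2_power_iff: "comp_group (flip ` Pow A) \<cong> Z2_power k \<longleftrightarrow> k = card A"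
proof
  assume "comp_group (flip ` Pow A) \<cong> Z2_power k"
  then have "card (flip ` Pow A) = 2 ^ k"
    using iso_same_card[of "comp_group (flip ` Pow A)" "Z2_power k"] card_Z2_power[of k]
    by (auto simp: is_iso_def comp_group_def)
  moreover have "card (flip ` Pow A) = 2 ^ card A"
    by (subst card_image) (auto simp: inj_on_def flip_eq_iff card_Pow)
  ultimately show "k = card A" by simp
qed (simp add: flips_iso_Z2_power)

section \<open>Coordinates of a global minimum\<close>

lemma potential_comb:
  "higgs_potential \<Lambda> M (comb x) = (\<Sum>i\<in>UNIV. minkowski $ i $ i * lam i * (x i)\<^sup>2 / 2 - x i * (M \<bullet> e i))"
proof -
  have "higgs_potential \<Lambda> M (comb x) =
      (\<Sum>i\<in>UNIV. minkowski $ i $ i * lam i * x i * x i) / 2 - (\<Sum>i\<in>UNIV. x i * (M \<bullet> e i))"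
    unfolding higgs_potential_def form_coord coord_comb inner_comb by simp
  then show ?thesis
    by (simp add: sum_divide_distrib sum_subtractf power2_eq_square mult.assoc)
qed

text \<open>Neither direction has a linear term, so only
  \<open>- (lam i * (x i)^2 + lam j * (x j)^2) / 2\<close> is at stake; for a fixed sum of squares
  it is smallest when all the weight sits on \<open>j\<close>.\<close>

lemma minimum_no_two_flips:
  assumes min: "global_minimum \<Lambda> M r"
    and "i \<noteq> 0" "j \<noteq> 0" "M \<bullet> e i = 0" "M \<bullet> e j = 0" "lam i < lam j"
  shows "coord i r = 0"
proof (rule ccontr)
  assume ri: "coord i r \<noteq> 0"
  have "i \<noteq> j" using assms(6) by auto
  define x where "x = (\<lambda>m. coord m r)"
  \<comment> \<open>Keeping the sum of the two squares preserves the Minkowski square, and the time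
    coordinate is untouched, so the new point stays in the cone.\<close>
  define y where "y = x(i := 0, j := sqrt ((x i)\<^sup>2 + (x j)\<^sup>2))"
  have split: "(\<Sum>m\<in>UNIV. F m) = F i + F j + (\<Sum>m\<in>- {i, j}. F m)" for F :: "4 \<Rightarrow> real"
    using \<open>i \<noteq> j\<close> by (simp add: Compl_eq_Diff_UNIV sum.remove[of UNIV i] sum.remove[of "UNIV - {i}" j]
        Diff_insert2[of UNIV i "{j}"] add.assoc)
  have y: "y i = 0" "(y j)\<^sup>2 = (x i)\<^sup>2 + (x j)\<^sup>2" "\<And>m. m \<notin> {i, j} \<Longrightarrow> y m = x m"
    using \<open>i \<noteq> j\<close> by (auto simp: y_def)
  have diag: "minkowski $ i $ i = - 1" "minkowski $ j $ j = - 1"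
    using assms(2,3) by (auto simp: minkowski_def)
  have r: "r = comb x" by (simp add: x_def)
  have "mdot (comb y) (comb y) = mdot r r"
    unfolding r mdot_coord coord_comb split using y
    by (simp add: diag power2_eq_square algebra_simps)
  moreover have "coord 0 (comb y) = coord 0 r"
    using y(3)[of 0] assms(2,3) by (simp add: x_def)
  moreover have "r \<in> forward_lightcone"
    using min by (simp add: global_minimum_def is_arg_min_def)
  ultimately have "comb y \<in> forward_lightcone"
    by (simp add: forward_lightcone_coord)
  then have "\<not> higgs_potential \<Lambda> M (comb y) < higgs_potential \<Lambda> M r"
    using min by (auto simp: global_minimum_def is_arg_min_def)
  moreover have "higgs_potential \<Lambda> M r - higgs_potential \<Lambda> M (comb y) = (lam j - lam i) * (x i)\<^sup>2 / 2"
    unfolding r potential_comb split using y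
    by (simp add: diag assms(4,5) field_simps)
  moreover have "(lam j - lam i) * (x i)\<^sup>2 / 2 > 0"
    using assms(6) ri by (simp add: x_def)
  ultimately show False by linarith
qed

text \<open>Of two directions in \<open>A\<close> the one with the smaller eigenvalue has coordinate
  0, so at most one coordinate survives. Allowing any subset \<open>A\<close> covers the lagrangian
  group as well.\<close>

lemma minimum_card_nonzero:
  assumes "global_minimum \<Lambda> M r" and A: "A \<subseteq> {i. i \<noteq> 0 \<and> M \<bullet> e i = 0}"
  shows "card {i \<in> A. coord i r = 0} \<in> {card A, card A - 1}"
proof (cases "\<exists>i\<in>A. coord i r \<noteq> 0")
  case True
  then obtain i where i: "i \<in> A" "coord i r \<noteq> 0" by blast
  have "coord j r = 0" if "j \<in> A" "j \<noteq> i" for j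
  proof -
    have "lam i < lam j \<or> lam j < lam i"
      using that(2) inj by (metis injD linorder_neqE_linordered_idom)
    then show ?thesis
      using minimum_no_two_flips[OF assms(1), of i j] minimum_no_two_flips[OF assms(1), of j i]
        A i that by blast
  qed
  then have "{i \<in> A. coord i r = 0} = A - {i}" using i(2) by auto
  then show ?thesis using i(1) by simp
next
  case False
  then have "{i \<in> A. coord i r = 0} = A" by auto
  then show ?thesis by simp
qed

lemma unbroken_flips:
  assumes "global_minimum \<Lambda> M r" and "A \<subseteq> {i. i \<noteq> 0 \<and> M \<bullet> e i = 0}"
    and "comp_group (flip ` Pow A) \<cong> Z2_power k"
  shows "comp_group (unbroken (flip ` Pow A) r) \<cong> Z2_power k \<or>
      comp_group (unbroken (flip ` Pow A) r) \<cong> Z2_power (k - 1)"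
  using assms(3) minimum_card_nonzero[OF assms(1,2)]
  by (auto simp: flips_iso_Z2_power_iff unbroken_eq)

end

section \<open>Existence of an eigenframe\<close>

lemma eigenvectors_orthogonal:
  assumes "transpose \<Lambda> = \<Lambda>" "l \<noteq> m"
    and "\<Lambda> *v v = l *\<^sub>R (minkowski *v v)" "\<Lambda> *v w = m *\<^sub>R (minkowski *v w)"
  shows "mdot v w = 0"
  using symmetric_form_commute[OF assms(1), of v w] assms(2)
  by (simp add: assms(3,4) mdot_def[symmetric] mdot_commute[of w v])

text \<open>On a null eigenvector the quadratic form of \<Lambda> vanishes, yet \<open>v\<close> or
  \<open>- v\<close> lies in the cone, where the form is positive.\<close>

lemma eigenvector_not_null:
  assumes "positive_on_lightcone \<Lambda>" "v \<noteq> 0" "\<Lambda> *v v = l *\<^sub>R (minkowski *v v)"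
  shows "mdot v v \<noteq> 0"
proof
  assume "mdot v v = 0"
  then have "v \<bullet> (\<Lambda> *v v) = 0"
    by (simp add: assms(3) mdot_def)
  moreover have "(- v) \<bullet> (\<Lambda> *v (- v)) = v \<bullet> (\<Lambda> *v v)"
    by (simp add: linear_neg[OF matrix_vector_mul_linear])
  moreover have "v \<in> forward_lightcone \<or> - v \<in> forward_lightcone"
    using \<open>mdot v v = 0\<close> by (auto simp: forward_lightcone_iff)
  moreover have "u \<bullet> (\<Lambda> *v u) > 0" if "u \<in> forward_lightcone" "u \<noteq> 0" for u
    using assms(1) that by (simp add: positive_on_lightcone_def)
  ultimately show False
    using assms(2) by (metis less_irrefl neg_equal_0_iff_equal)
qed

lemma timelike_not_orthogonal:
  assumes "mdot u u > 0" "mdot w w > 0"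
  shows "mdot u w \<noteq> 0"
proof -
  have pos: "mdot u' w' > 0" if "u' $ 0 > 0" "w' $ 0 > 0" "mdot u' u' > 0" "mdot w' w' > 0" for u' w'
    by (rule timelike_pairing_pos) (use that in auto)
  have "u $ 0 \<noteq> 0" "w $ 0 \<noteq> 0"
    using time_component_nonzero[of u] time_component_nonzero[of w] assms by force+
  then consider "u $ 0 > 0" "w $ 0 > 0" | "u $ 0 > 0" "w $ 0 < 0"
    | "u $ 0 < 0" "w $ 0 > 0" | "u $ 0 < 0" "w $ 0 < 0"
    by linarith
  then show ?thesis
    using pos[of u w] pos[of u "- w"] pos[of "- u" w] pos[of "- u" "- w"] assms by cases auto
qed

text \<open>Orthogonal non-null vectors are independent, so \<open>axis 0 1\<close> expands in them.
  Its Minkowski square 1 is then a sum of terms \<open>(x $ i)^2 * mdot (w i) (w i)\<close>, one of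
  which must be positive.\<close>

lemma orthogonal_basis_timelike:
  fixes w :: "4 \<Rightarrow> real ^ 4"
  assumes orth: "\<And>i j. i \<noteq> j \<Longrightarrow> mdot (w i) (w j) = 0" and nz: "\<And>i. mdot (w i) (w i) \<noteq> 0"
  obtains t where "mdot (w t) (w t) > 0"
proof -
  define f where "f x = (\<Sum>i\<in>UNIV. x $ i *\<^sub>R w i)" for x :: "real ^ 4"
  have w_f: "mdot (w j) (f x) = x $ j * mdot (w j) (w j)" for j x
  proof -
    have "mdot (w j) (f x) = (\<Sum>i\<in>UNIV. if j = i then x $ j * mdot (w j) (w j) else 0)"
      unfolding f_def mdot_sum_right by (intro sum.cong) (auto simp: orth)
    then show ?thesis by simp
  qed
  have "linear f"
    by (rule linearI) (simp_all add: f_def scaleR_add_left sum.distrib scaleR_sum_right)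
  moreover have "inj f"
    using w_f nz by (intro injI) (metis mult_cancel_right vec_eq_iff)
  ultimately obtain x where x: "axis 0 1 = f x"
    by (metis linear_injective_imp_surjective surjD)
  have "mdot (f x) (f x) = (\<Sum>i\<in>UNIV. x $ i * mdot (w i) (f x))"
    by (subst f_def, subst mdot_commute) (simp add: mdot_sum_right mdot_commute[of "f x" "w i" for i])
  then have "1 = (\<Sum>i\<in>UNIV. (x $ i)\<^sup>2 * mdot (w i) (w i))"
    by (simp add: x[symmetric] mdot_axis) (simp add: x w_f minkowski_def power2_eq_square mult.assoc)
  then have "\<exists>i. \<not> (x $ i)\<^sup>2 * mdot (w i) (w i) \<le> 0"
    by (metis (no_types, lifting) not_one_le_zero sum_nonpos)
  then obtain i where "mdot (w i) (w i) > 0"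
    by (metis mult_nonneg_nonpos not_le zero_le_power2)
  then show ?thesis using that by blast
qed

text \<open>Eigenvectors for the four distinct eigenvalues are orthogonal and non-null, so they can
  be normalized to square 1 or -1. Exactly one is timelike; it is moved to index 0 and oriented to
  the future.\<close>

lemma quartic_tensor_eigenframe:
  assumes "quartic_tensor \<Lambda>"
  obtains e lam where "eigenframe \<Lambda> e lam"
proof -
  let ?S = "{l. minkowski_eigenvalue \<Lambda> l}"
  have sym: "transpose \<Lambda> = \<Lambda>" and pos: "positive_on_lightcone \<Lambda>"
    using assms by (auto simp: quartic_tensor_def)
  obtain a b c d where abcd: "?S = {a, b, c, d}" "distinct [a, b, c, d]" "0 \<notin> {a, b, c, d}"
    using assms unfolding quartic_tensor_def by blast
  have S: "finite ?S" "card ?S = card (UNIV :: 4 set)" "0 \<notin> ?S"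
    unfolding abcd(1) using abcd(2,3) by simp_all
  obtain l where l: "bij_betw l (UNIV :: 4 set) ?S"
    using finite_same_card_bij[of "UNIV :: 4 set" ?S] S(1,2) by auto
  then have inj: "inj l" and ev: "minkowski_eigenvalue \<Lambda> (l i)" for i
    by (auto simp: bij_betw_def)
  obtain v where v: "\<And>i. v i \<noteq> 0" "\<And>i. \<Lambda> *v v i = l i *\<^sub>R (minkowski *v v i)"
    using ev unfolding minkowski_eigenvalue_def by metis
  define w where "w i = (1 / sqrt \<bar>mdot (v i) (v i)\<bar>) *\<^sub>R v i" for i
  have v_nz: "mdot (v i) (v i) \<noteq> 0" for i
    using eigenvector_not_null[OF pos v] .
  have w_eig: "\<Lambda> *v w i = l i *\<^sub>R (minkowski *v w i)" for i
    by (simp add: w_def matrix_vector_mult_scaleR v(2))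
  have w_orth: "mdot (w i) (w j) = 0" if "i \<noteq> j" for i j
    using eigenvectors_orthogonal[OF sym _ w_eig w_eig] that inj by (auto simp: inj_eq)
  have w_norm: "mdot (w i) (w i) = sgn (mdot (v i) (v i))" for i
    using v_nz[of i] by (simp add: w_def sgn_if)
  then have w_nz: "mdot (w i) (w i) \<noteq> 0" for i
    using v_nz by (simp add: sgn_zero_iff)
  obtain t where t: "mdot (w t) (w t) > 0"
    using orthogonal_basis_timelike[of w] w_orth w_nz by metis
  have w_t: "mdot (w t) (w t) = 1"
    using t by (simp add: w_norm sgn_if split: if_splits)
  \<comment> \<open>A second timelike vector could not be orthogonal to \<open>w t\<close>.\<close>
  have w_other: "mdot (w i) (w i) = - 1" if "i \<noteq> t" for i
    using timelike_not_orthogonal[OF t, of "w i"] w_orth[of t i] that w_nz[of i]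
    by (auto simp: w_norm sgn_if split: if_splits)
  \<comment> \<open>\<open>p\<close> exchanges 0 and \<open>t\<close>; the sign \<open>s\<close>
    below reverses the timelike vector if it points to the past.\<close>
  define p where "p i = (if i = 0 then t else if i = t then 0 else i)" for i :: 4
  have p: "inj p" by (auto simp: inj_def p_def)
  define s where "s i = (if i = 0 then sgn (w t $ 0) else 1)" for i :: 4
  have "w t $ 0 \<noteq> 0"
    using time_component_nonzero[of "w t"] t by force
  then have s: "s i * s i = 1" "s 0 * w t $ 0 > 0" for i
    by (auto simp: s_def sgn_if)
  define e where "e i = s i *\<^sub>R w (p i)" for i
  have "eigenframe \<Lambda> e (l \<circ> p)"
  proof
    show "mdot (e i) (e j) = minkowski $ i $ j" for i j
    proof (cases "i = j")
      case True
      have "mdot (e i) (e i) = mdot (w (p i)) (w (p i))"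
        using s(1)[of i] by (simp add: e_def flip: mult.assoc)
      then show ?thesis
        using True w_t w_other[of "p i"] by (auto simp: p_def minkowski_def split: if_splits)
    next
      case False
      then show ?thesis
        using w_orth[of "p i" "p j"] p by (simp add: e_def inj_eq minkowski_def)
    qed
    show "\<Lambda> *v e i = (l \<circ> p) i *\<^sub>R (minkowski *v e i)" for i
      by (simp add: e_def matrix_vector_mult_scaleR w_eig)
    show "e 0 $ 0 > 0" using s(2) by (simp add: e_def p_def)
    show "inj (l \<circ> p)" using inj p by (rule inj_compose)
    show "(l \<circ> p) i \<noteq> 0" for i using ev[of "p i"] S(3) by auto
  qed (rule sym)
  then show ?thesis using that by blast
qed

section \<open>A family of potentials with a broken symmetry\<close>

definition example_tensor :: "real ^ 4 ^ 4" where
  "example_tensor = (\<chi> i j. if i = j then (if i = 1 then - 1 else if i = 2 then 1 else 2) else 0)"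

text \<open>Direction 1 has the largest spacelike eigenvalue, so it is the one along which the
  minimum can break a flip.\<close>

definition example_eigenvalue :: "4 \<Rightarrow> real" where
  "example_eigenvalue i = (if i = 0 then 2 else if i = 1 then 1 else if i = 2 then - 1 else - 2)"

text \<open>The coefficients make the completed squares centre at 2, \<open>a\<close> and
  \<open>b\<close> in components 0, 2 and 3. Setting \<open>a\<close> or \<open>b\<close> to 0
  restores the flip in direction 2 or 3.\<close>

definition example_linear :: "real \<Rightarrow> real \<Rightarrow> real ^ 4" where
  "example_linear a b = (\<chi> i. if i = 0 then 2 else if i = 1 then 0 else if i = 2 then 2 * a else 3 * b)"

text \<open>For \<open>a^2 + b^2 \<le> 4\<close>, component 1 places the point on the surface of the
  cone.\<close>

definition example_minimum :: "real \<Rightarrow> real \<Rightarrow> real ^ 4" where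
  "example_minimum a b = (\<chi> i. if i = 0 then 2 else if i = 1 then sqrt (4 - a\<^sup>2 - b\<^sup>2) else if i = 2 then a else b)"

lemma example_form: "r \<bullet> (example_tensor *v r) = 2 * (r $ 0)\<^sup>2 - (r $ 1)\<^sup>2 + (r $ 2)\<^sup>2 + 2 * (r $ 3)\<^sup>2"
  by (simp add: example_tensor_def matrix_vector_mult_def inner_vec_def sum_UNIV_4 power2_eq_square)

interpretation example: eigenframe example_tensor "\<lambda>i. axis i 1" example_eigenvalue
proof
  show "transpose example_tensor = example_tensor"
    by (simp add: transpose_def example_tensor_def vec_eq_iff)
  have "\<forall>i. example_tensor *v axis i 1 = example_eigenvalue i *\<^sub>R (minkowski *v axis i 1)"
    by (simp add: all_4_iff vec_eq_iff example_tensor_def example_eigenvalue_def minkowski_def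
        matrix_vector_mult_def sum_UNIV_4 axis_def)
  then show "example_tensor *v axis i 1 = example_eigenvalue i *\<^sub>R (minkowski *v axis i 1)" for i
    by blast
  have "\<forall>i j. example_eigenvalue i = example_eigenvalue j \<longrightarrow> i = j"
    by (simp add: all_4_iff example_eigenvalue_def)
  then show "inj example_eigenvalue" by (simp add: inj_def)
qed (simp_all add: mdot_axis example_eigenvalue_def)

lemma example_quartic_tensor: "quartic_tensor example_tensor"
proof -
  have "r \<bullet> (example_tensor *v r) > 0" if "r \<in> forward_lightcone - {0}" for r
  proof -
    have "r $ 0 \<noteq> 0"
      using that by (intro time_component_nonzero) (auto simp: forward_lightcone_iff)
    moreover have "(r $ 0)\<^sup>2 - (r $ 1)\<^sup>2 - (r $ 2)\<^sup>2 - (r $ 3)\<^sup>2 \<ge> 0"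
      using that by (simp add: forward_lightcone_def)
    \<comment> \<open>The cone inequality bounds the form below by
      \<open>(r $ 0)^2 + 2 * (r $ 2)^2 + 3 * (r $ 3)^2\<close>.\<close>
    ultimately show ?thesis
      unfolding example_form by (smt (verit) zero_less_power2 zero_le_power2)
  qed
  moreover have "{l. minkowski_eigenvalue example_tensor l} = {2, 1, - 1, - 2}"
    unfolding example.eigenvalue_iff UNIV_4_eq by (auto simp: example_eigenvalue_def)
  ultimately show ?thesis
    unfolding quartic_tensor_def positive_on_lightcone_def using example.symmetric
    by (intro conjI exI[of _ 2] exI[of _ 1] exI[of _ "- 1"] exI[of _ "- 2"]) auto
qed

text \<open>On the light cone \<open>(r $ 1)\<^sup>2 \<le> (r $ 0)\<^sup>2 - (r $ 2)\<^sup>2 - (r $ 3)\<^sup>2\<close>, and after this substitution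
  the potential separates into convex quadratics in the other three components.\<close>
lemma example_global_minimum:
  assumes "a\<^sup>2 + b\<^sup>2 \<le> 4"
  shows "global_minimum example_tensor (example_linear a b) (example_minimum a b)"
proof -
  let ?V = "higgs_potential example_tensor (example_linear a b)"
  let ?m = "example_minimum a b"
  have V: "?V r = (r $ 0)\<^sup>2 - (r $ 1)\<^sup>2 / 2 + (r $ 2)\<^sup>2 / 2 + (r $ 3)\<^sup>2
      - 2 * r $ 0 - 2 * a * r $ 2 - 3 * b * r $ 3" for r
    unfolding higgs_potential_def example_form
    by (simp add: example_linear_def inner_vec_def sum_UNIV_4 field_simps)
  have sq: "?V r = ((r $ 0 - 2)\<^sup>2 + 2 * (r $ 2 - a)\<^sup>2 + 3 * (r $ 3 - b)\<^sup>2
      + ((r $ 0)\<^sup>2 - (r $ 1)\<^sup>2 - (r $ 2)\<^sup>2 - (r $ 3)\<^sup>2)) / 2 - 2 - a\<^sup>2 - 3 / 2 * b\<^sup>2" for r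
    unfolding V by (simp add: power2_eq_square field_simps)
  have m: "?m $ 0 = 2" "(?m $ 1)\<^sup>2 = 4 - a\<^sup>2 - b\<^sup>2" "?m $ 2 = a" "?m $ 3 = b"
    using assms by (auto simp: example_minimum_def)
  have "?m \<in> forward_lightcone"
    by (simp add: forward_lightcone_def m)
  moreover have "?V ?m \<le> ?V r" if "r \<in> forward_lightcone" for r
    using that unfolding sq by (simp add: m forward_lightcone_def)
  ultimately show ?thesis
    by (auto simp: global_minimum_def is_arg_min_def not_less)
qed

lemma kinetic_vector_axis: "kinetic_vector (axis 0 1)"
proof -
  have "minkowski *v axis 0 1 = axis 0 1"
    by (simp add: vec_eq_iff all_4_iff minkowski_def matrix_vector_mult_def sum_UNIV_4 axis_def)
  then show ?thesis
    by (simp add: kinetic_vector_def forward_lightcone_def axis_def inner_axis_axis[unfolded axis_def])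
qed

text \<open>The purely timelike \<open>K = axis 0 1\<close> is invariant under every spatial flip,
  so both groups coincide here.\<close>

lemma example_symmetries:
  assumes "Sym = (\<lambda>\<Lambda> M K. potential_symmetries \<Lambda> M) \<or> Sym = lagrangian_symmetries"
  shows "Sym example_tensor (example_linear a b) (axis 0 1) =
    example.flip ` Pow ({1} \<union> (if a = 0 then {2} else {}) \<union> (if b = 0 then {3} else {}))"
proof -
  let ?A = "{1 :: 4} \<union> (if a = 0 then {2} else {}) \<union> (if b = 0 then {3} else {})"
  have "\<forall>i. i \<noteq> 0 \<and> example_linear a b \<bullet> axis i 1 = 0 \<longleftrightarrow> i \<in> ?A"
    by (simp add: all_4_iff inner_axis example_linear_def)
  then have pot: "{i. i \<noteq> 0 \<and> example_linear a b \<bullet> axis i 1 = 0} = ?A"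
    by blast
  have "axis 0 1 \<bullet> axis i (1::real) = 0" if "i \<noteq> 0" for i :: 4
    using that by (simp add: inner_axis_axis)
  then have lag: "{i. i \<noteq> 0 \<and> example_linear a b \<bullet> axis i 1 = 0 \<and> axis 0 1 \<bullet> axis i (1::real) = 0} = ?A"
    unfolding pot[symmetric] by blast
  from assms show ?thesis
  proof
    assume "Sym = (\<lambda>\<Lambda> M K. potential_symmetries \<Lambda> M)"
    then show ?thesis by (simp only: example.potential_symmetries_eq pot)
  next
    assume "Sym = lagrangian_symmetries"
    then show ?thesis by (simp only: example.lagrangian_symmetries_eq lag)
  qed
qed

lemma example_breaking:
  fixes a b :: real
  assumes "Sym = (\<lambda>\<Lambda> M K. potential_symmetries \<Lambda> M) \<or> Sym = lagrangian_symmetries"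
    and "a \<in> {0, 1}" "b \<in> {0, 1}"
    and "k = 1 + (if a = 0 then 1 else 0) + (if b = 0 then 1 else 0)"
  shows "\<exists>\<Lambda> M K r. quartic_tensor \<Lambda> \<and> kinetic_vector K \<and>
    comp_group (Sym \<Lambda> M K) \<cong> Z2_power k \<and> global_minimum \<Lambda> M r \<and>
    comp_group (unbroken (Sym \<Lambda> M K) r) \<cong> Z2_power (k - 1)"
proof -
  define A where "A = {1 :: 4} \<union> (if a = 0 then {2} else {}) \<union> (if b = 0 then {3} else {})"
  let ?M = "example_linear a b" and ?m = "example_minimum a b"
  have card: "card A = k" "card (A - {1}) = k - 1"
    by (auto simp: A_def assms(4))
  have "\<forall>i. mdot (axis i 1) r = minkowski $ i $ i * r $ i" for r
    by (simp add: all_4_iff mdot_components minkowski_def axis_def)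
  then have coord: "example.coord i r = r $ i" for i r
    by (simp add: example.coord_def mult_minkowski_diag)
  \<comment> \<open>Component 1 is the root of \<open>4 - a^2 - b^2 \<ge> 2\<close>, hence nonzero;
    2 and 3 belong to \<open>A\<close> only when \<open>a\<close> or \<open>b\<close>, the matching
    component, is 0.\<close>
  have "\<forall>i. i \<in> A \<and> example.coord i ?m = 0 \<longleftrightarrow> i \<in> A - {1}"
    using assms(2,3)
    by (auto simp: all_4_iff coord A_def example_minimum_def)
  then have "{i \<in> A. example.coord i ?m = 0} = A - {1}" by blast
  moreover have "Sym example_tensor ?M (axis 0 1) = example.flip ` Pow A"
    unfolding A_def using assms(1) by (rule example_symmetries)
  ultimately have "comp_group (Sym example_tensor ?M (axis 0 1)) \<cong> Z2_power k"
    "comp_group (unbroken (Sym example_tensor ?M (axis 0 1)) ?m) \<cong> Z2_power (k - 1)"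
    by (simp_all add: example.flips_iso_Z2_power_iff example.unbroken_eq card)
  moreover have "global_minimum example_tensor ?M ?m"
    using assms(2,3) by (intro example_global_minimum) auto
  ultimately show ?thesis
    using example_quartic_tensor kinetic_vector_axis by blast
qed

section \<open>The dichotomy at every minimum and the occurrence of breaking\<close>

theorem proposition3:
  fixes Sym :: "real ^ 4 ^ 4 \<Rightarrow> real ^ 4 \<Rightarrow> real ^ 4 \<Rightarrow> (real ^ 4 \<Rightarrow> real ^ 4) set"
    and k :: nat
  assumes "Sym = (\<lambda>\<Lambda> M K. potential_symmetries \<Lambda> M) \<or> Sym = lagrangian_symmetries"
    and "k \<in> {1, 2, 3}"
  shows "(\<forall>\<Lambda> M K r.
            quartic_tensor \<Lambda> \<and> kinetic_vector K \<and>
            comp_group (Sym \<Lambda> M K) \<cong> Z2_power k \<and>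
            global_minimum \<Lambda> M r \<longrightarrow>
              comp_group (unbroken (Sym \<Lambda> M K) r) \<cong> Z2_power k \<or>
              comp_group (unbroken (Sym \<Lambda> M K) r) \<cong> Z2_power (k - 1))
       \<and> (\<exists>\<Lambda> M K r.
            quartic_tensor \<Lambda> \<and> kinetic_vector K \<and>
            comp_group (Sym \<Lambda> M K) \<cong> Z2_power k \<and>
            global_minimum \<Lambda> M r \<and>
            comp_group (unbroken (Sym \<Lambda> M K) r) \<cong> Z2_power (k - 1))"
proof (intro conjI allI impI)
  fix \<Lambda> M K r
  assume *: "quartic_tensor \<Lambda> \<and> kinetic_vector K \<and> comp_group (Sym \<Lambda> M K) \<cong> Z2_power k \<and>
    global_minimum \<Lambda> M r"
  then obtain e lam where "eigenframe \<Lambda> e lam"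
    using quartic_tensor_eigenframe by blast
  then interpret eigenframe \<Lambda> e lam .
  \<comment> \<open>Either group consists of all flips inside one set \<open>A\<close>, which treats
    both cases at once.\<close>
  obtain A where A: "Sym \<Lambda> M K = flip ` Pow A" "A \<subseteq> {i. i \<noteq> 0 \<and> M \<bullet> e i = 0}"
    using assms(1)
  proof
    assume "Sym = (\<lambda>\<Lambda> M K. potential_symmetries \<Lambda> M)"
    with that[OF _ order_refl] show ?thesis by (simp add: potential_symmetries_eq)
  next
    assume "Sym = lagrangian_symmetries"
    with that[of "{i. i \<noteq> 0 \<and> M \<bullet> e i = 0 \<and> K \<bullet> e i = 0}"] show ?thesis
      by (auto simp: lagrangian_symmetries_eq)
  qed
  show "comp_group (unbroken (Sym \<Lambda> M K) r) \<cong> Z2_power k \<or>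
      comp_group (unbroken (Sym \<Lambda> M K) r) \<cong> Z2_power (k - 1)"
    using * unbroken_flips[OF _ A(2)] by (simp add: A(1))
next
  \<comment> \<open>Each vanishing parameter adds one flip to the broken one: (\<open>a\<close>,
    \<open>b\<close>) = (1, 1), (0, 1), (0, 0) give \<open>k\<close> = 1, 2, 3.\<close>
  consider "k = 1" | "k = 2" | "k = 3" using assms(2) by blast
  then show "\<exists>\<Lambda> M K r. quartic_tensor \<Lambda> \<and> kinetic_vector K \<and>
      comp_group (Sym \<Lambda> M K) \<cong> Z2_power k \<and> global_minimum \<Lambda> M r \<and>
      comp_group (unbroken (Sym \<Lambda> M K) r) \<cong> Z2_power (k - 1)"
    by cases (rule example_breaking[OF assms(1), of 1 1] example_breaking[OF assms(1), of 0 1]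
        example_breaking[OF assms(1), of 0 0]; simp; fail)+
qed

end
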